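(* Let $\Omega\subset\mathbb R^n$ be an unbounded domain. Let $a^{ij},b^i,c\in C^0(\overline\Omega,\mathbb R)$ ($i,j=1,\dots,n$) be such that the matrix $(a^{ij}(x))$ is symmetric and positive definite for every $x\in\overline\Omega$. Assume there are constants $H<\infty$ and $\Lambda<\infty$ with $$\|a^{ij}\|_{C^0(\Omega)}+\|b^i\|_{C^0(\Omega)}+\|c\|_{C^0(\Omega)}\le H\quad (i,j=1,\dots,n),\qquad c(x)\le 0\ \text{ in }\Omega,$$ $$\frac1\Lambda|\xi|^2\le a^{ij}(x)\xi_i\xi_j\le\Lambda|\xi|^2\quad\text{for all }x\in\Omega,\ \xi\in\mathbb R^n.$$ Assume moreover: a) $\Omega$ has bounded thickness, i.e. $\sup_{x\in\Omega}\operatorname{dist}(x,\partial\Omega)<+\infty$. b) $u_1,u_2\in C^2(\Omega,\mathbb R)\cap C^0(\overline\Omega,\mathbb R)$ are two solutions of $$a^{ij}(x)\partial_{ij}u+b^i(x)\partial_iu+c(x)u=f\ \text{ in }\Omega,\qquad u=g\ \text{ on }\partial\Omega,$$ for one and the same right side $f:\Omega\to\mathbb R$ and the same boundary values $g:\partial\Omega\to\mathbb R$, and the difference $|u_1(x)-u_2(x)|$ is uniformly bounded in $\Omega$. c) $\Omega$ satisfies a uniform exterior sphere condition. Then $u_1\equiv u_2$ in $\Omega$.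
   Context: A domain is a nonempty connected open set. The summation convention is used: repeated indices $i,j$ are summed from $1$ to $n$. $\partial_i,\partial_{ij}$ denote first and second partial derivatives. $\|\cdot\|_{C^0(\Omega)}$ is the supremum norm on $\Omega$. $\operatorname{dist}(x,\partial\Omega)=\inf_{y\in\partial\Omega}|x-y|$, with the usual convention that the infimum over the empty set is $+\infty$. Uniform exterior sphere condition: there exists some $r>0$ such that for each $x_0\in\partial\Omega$ there exists some $x_1\in\mathbb R^n$ with $\overline{B_r(x_1)}\cap\overline\Omega=\{x_0\}$, where $B_r(x_1)$ is the open ball of radius $r$ centered at $x_1$. *)

theory Defs
  imports "HOL-Analysis.Analysis"
begin

definition partial_deriv :: "'n \<Rightarrow> (real ^ 'n \<Rightarrow> real) \<Rightarrow> real ^ 'n \<Rightarrow> real" where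
  "partial_deriv i u x = deriv (\<lambda>t. u (x + t *\<^sub>R axis i 1)) 0"

definition has_partial_deriv :: "'n \<Rightarrow> (real ^ 'n \<Rightarrow> real) \<Rightarrow> real ^ 'n \<Rightarrow> bool" where
  "has_partial_deriv i u x \<longleftrightarrow> (\<lambda>t. u (x + t *\<^sub>R axis i 1)) field_differentiable (at 0)"

(* Intended for open S only: then the partial derivatives at points of S do not depend on
   the values of u outside S. *)
primrec Ck_on :: "nat \<Rightarrow> (real ^ 'n) set \<Rightarrow> (real ^ 'n \<Rightarrow> real) \<Rightarrow> bool" where
  "Ck_on 0 S u \<longleftrightarrow> continuous_on S u"
| "Ck_on (Suc k) S u \<longleftrightarrow>
     continuous_on S u \<and>
     (\<forall>i. (\<forall>x\<in>S. has_partial_deriv i u x) \<and> Ck_on k S (partial_deriv i u))"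

(* Extended-real valued, so that the norm of an unbounded function is infinite. *)
definition sup_norm :: "'a set \<Rightarrow> ('a \<Rightarrow> real) \<Rightarrow> ereal" where
  "sup_norm S f = (SUP x\<in>S. ereal \<bar>f x\<bar>)"

(* Unlike infdist, which is 0 for the empty set, this is infinite there. *)
definition edist_set :: "'a::metric_space \<Rightarrow> 'a set \<Rightarrow> ereal" where
  "edist_set x S = (INF y\<in>S. ereal (dist x y))"

definition bounded_thickness :: "'a::metric_space set \<Rightarrow> bool" where
  "bounded_thickness S \<longleftrightarrow> (SUP x\<in>S. edist_set x (frontier S)) < \<infinity>"

definition uniform_exterior_sphere :: "'a::metric_space set \<Rightarrow> bool" where
  "uniform_exterior_sphere S \<longleftrightarrow>
     (\<exists>r>0. \<forall>x0\<in>frontier S. \<exists>x1. closure (ball x1 r) \<inter> closure S = {x0})"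

definition quad_form :: "real ^ 'n ^ 'n \<Rightarrow> real ^ 'n \<Rightarrow> real" where
  "quad_form A \<xi> = (\<Sum>i\<in>UNIV. \<Sum>j\<in>UNIV. A $ i $ j * \<xi> $ i * \<xi> $ j)"

definition sym_pos_def :: "real ^ 'n ^ 'n \<Rightarrow> bool" where
  "sym_pos_def A \<longleftrightarrow> transpose A = A \<and> (\<forall>\<xi>. \<xi> \<noteq> 0 \<longrightarrow> quad_form A \<xi> > 0)"

definition elliptic_op ::
  "(real ^ 'n \<Rightarrow> real ^ 'n ^ 'n) \<Rightarrow> (real ^ 'n \<Rightarrow> real ^ 'n) \<Rightarrow> (real ^ 'n \<Rightarrow> real)
     \<Rightarrow> (real ^ 'n \<Rightarrow> real) \<Rightarrow> real ^ 'n \<Rightarrow> real" where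
  "elliptic_op a b c u x =
     (\<Sum>i\<in>UNIV. \<Sum>j\<in>UNIV. a x $ i $ j * partial_deriv i (partial_deriv j u) x)
     + (\<Sum>i\<in>UNIV. b x $ i * partial_deriv i u x)
     + c x * u x"

definition dirichlet_solution ::
  "(real ^ 'n) set \<Rightarrow> (real ^ 'n \<Rightarrow> real ^ 'n ^ 'n) \<Rightarrow> (real ^ 'n \<Rightarrow> real ^ 'n)
     \<Rightarrow> (real ^ 'n \<Rightarrow> real) \<Rightarrow> (real ^ 'n \<Rightarrow> real) \<Rightarrow> (real ^ 'n \<Rightarrow> real)
     \<Rightarrow> (real ^ 'n \<Rightarrow> real) \<Rightarrow> bool" where
  "dirichlet_solution \<Omega> a b c f g u \<longleftrightarrow>
     Ck_on 2 \<Omega> u \<and> continuous_on (closure \<Omega>) u \<and>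
     (\<forall>x\<in>\<Omega>. elliptic_op a b c u x = f x) \<and>
     (\<forall>x\<in>frontier \<Omega>. u x = g x)"

end

theory Submission
  imports Defs
begin

text \<open>
  Let \<open>w = u1 - u2\<close> and \<open>M = sup \<bar>w\<bar>\<close>. Every point \<open>x\<close> of the domain lies within a fixed
  distance \<open>\<rho>\<close> of the centre \<open>p\<close> of an exterior ball of radius \<open>r\<close>. On the part of the domain in
  the ball of radius \<open>R = 2 * \<rho>\<close> around \<open>p\<close>, a multiple of
  \<open>exp (- \<alpha> * r\<^sup>2) - exp (- \<alpha> * \<bar>y - p\<bar>\<^sup>2)\<close> with large \<open>\<alpha>\<close> is a strict supersolution that is
  nonnegative and equals \<open>M\<close> at distance \<open>R\<close>. The weak maximum principle bounds \<open>w x\<close> by its value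
  at distance \<open>\<rho>\<close>, which is \<open>\<theta> * M\<close> with a factor \<open>\<theta> < 1\<close> independent of \<open>x\<close>. By symmetry
  \<open>M \<le> \<theta> * M\<close>, so \<open>M = 0\<close>.
\<close>

section \<open>Functions with continuous partial derivatives\<close>

lemma eventually_line_in_open:
  fixes x :: "'a::real_normed_vector"
  assumes "open S" "x \<in> S"
  shows "\<forall>\<^sub>F t in nhds 0. x + t *\<^sub>R \<xi> \<in> S"
proof -
  have "open ((\<lambda>t::real. x + t *\<^sub>R \<xi>) -` S)"
    by (intro open_vimage assms continuous_intros)
  moreover have "0 \<in> (\<lambda>t::real. x + t *\<^sub>R \<xi>) -` S"
    using assms by simp
  ultimately show ?thesis
    using eventually_nhds_in_open by fastforce
qed

text \<open>Only the values of the functions near \<open>x\<close> enter. This matters because the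
  formulas for derivatives of a difference are known only on \<open>S\<close>, so they cannot be
  substituted under a further \<open>partial_deriv\<close> as equalities of functions.\<close>

lemma partial_deriv_cong:
  fixes S :: "(real ^ 'n) set"
  assumes "open S" "x \<in> S" "\<And>y. y \<in> S \<Longrightarrow> u y = v y"
  shows "partial_deriv i u x = partial_deriv i v x"
    and "has_partial_deriv i u x = has_partial_deriv i v x"
proof -
  have ev: "\<forall>\<^sub>F t in nhds 0. u (x + t *\<^sub>R axis i 1) = v (x + t *\<^sub>R axis i 1)"
    using eventually_line_in_open[OF assms(1,2), of "axis i 1"]
    by eventually_elim (rule assms(3))
  show "partial_deriv i u x = partial_deriv i v x"
    unfolding partial_deriv_def by (rule deriv_cong_ev[OF ev refl])
  show "has_partial_deriv i u x = has_partial_deriv i v x"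
    unfolding has_partial_deriv_def field_differentiable_def
    using DERIV_cong_ev[OF refl ev refl] by simp
qed

lemma has_partial_deriv_iff:
  "has_partial_deriv i u x \<longleftrightarrow>
     ((\<lambda>t. u (x + t *\<^sub>R axis i 1)) has_real_derivative partial_deriv i u x) (at 0)"
  unfolding has_partial_deriv_def partial_deriv_def
  by (auto simp: DERIV_deriv_iff_field_differentiable)

lemma partial_deriv_eqI:
  assumes "((\<lambda>t. u (x + t *\<^sub>R axis i 1)) has_real_derivative D) (at 0)"
  shows "has_partial_deriv i u x" "partial_deriv i u x = D"
  using assms unfolding has_partial_deriv_def partial_deriv_def field_differentiable_def
  by (auto intro: DERIV_imp_deriv)

lemma Ck_on_cong:
  fixes S :: "(real ^ 'n) set"
  assumes "open S" "\<And>y. y \<in> S \<Longrightarrow> u y = v y" "Ck_on k S u"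
  shows "Ck_on k S v"
  using assms(2,3)
proof (induction k arbitrary: u v)
  case 0
  from 0(2) have "continuous_on S u" by simp
  then have "continuous_on S v" by (rule continuous_on_eq) (rule 0(1))
  then show ?case by simp
next
  case (Suc k)
  have "Ck_on k S (partial_deriv i v)" for i
    by (rule Suc.IH[of "partial_deriv i u"])
       (use Suc.prems(2) in \<open>auto intro: partial_deriv_cong(1)[OF assms(1)] Suc.prems(1)\<close>)
  moreover have "has_partial_deriv i v x" if "x \<in> S" for i x
    using Suc.prems(2) partial_deriv_cong(2)[OF assms(1) that, of u v, OF Suc.prems(1)] that by auto
  moreover have "continuous_on S u" using Suc.prems(2) by simp
  then have "continuous_on S v" by (rule continuous_on_eq) (rule Suc.prems(1))
  ultimately show ?case by auto
qed

lemma Ck_on_subset: "Ck_on k S u \<Longrightarrow> T \<subseteq> S \<Longrightarrow> Ck_on k T u"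
  by (induction k arbitrary: u) (auto intro: continuous_on_subset)

lemma partial_deriv_diff:
  assumes "has_partial_deriv i u x" "has_partial_deriv i v x"
  shows "has_partial_deriv i (\<lambda>x. u x - v x) x"
    and "partial_deriv i (\<lambda>x. u x - v x) x = partial_deriv i u x - partial_deriv i v x"
  using partial_deriv_eqI[OF DERIV_diff[OF assms[unfolded has_partial_deriv_iff]]] by auto

lemma Ck_on_diff:
  fixes S :: "(real ^ 'n) set"
  assumes "open S" "Ck_on k S u" "Ck_on k S v"
  shows "Ck_on k S (\<lambda>x. u x - v x)"
  using assms(2,3)
proof (induction k arbitrary: u v)
  case 0
  then show ?case by (auto intro: continuous_intros)
next
  case (Suc k)
  have "Ck_on k S (partial_deriv i (\<lambda>x. u x - v x))" for i
    by (rule Ck_on_cong[OF assms(1) _ Suc.IH[of "partial_deriv i u" "partial_deriv i v"]])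
       (use Suc.prems in \<open>auto simp: partial_deriv_diff\<close>)
  with Suc.prems show ?case
    by (auto intro: continuous_intros partial_deriv_diff)
qed

lemma elliptic_op_diff:
  fixes S :: "(real ^ 'n) set"
  assumes S: "open S" "x \<in> S" and u: "Ck_on 2 S u" and v: "Ck_on 2 S v"
  shows "elliptic_op a b c (\<lambda>x. u x - v x) x = elliptic_op a b c u x - elliptic_op a b c v x"
proof -
  have u1: "has_partial_deriv i u y" and v1: "has_partial_deriv i v y"
    and u2: "has_partial_deriv i (partial_deriv j u) y"
    and v2: "has_partial_deriv i (partial_deriv j v) y" if "y \<in> S" for y i j
    using u v that by (auto simp: numeral_2_eq_2)
  have d1: "partial_deriv i (\<lambda>x. u x - v x) y = partial_deriv i u y - partial_deriv i v y"
    if "y \<in> S" for i y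
    using u1 v1 that by (simp add: partial_deriv_diff)
  have d2: "partial_deriv i (partial_deriv j (\<lambda>x. u x - v x)) x =
      partial_deriv i (partial_deriv j u) x - partial_deriv i (partial_deriv j v) x" for i j
    using partial_deriv_cong(1)[OF S, of "partial_deriv j (\<lambda>x. u x - v x)"
        "\<lambda>y. partial_deriv j u y - partial_deriv j v y" i] d1 u2 v2 S
    by (simp add: partial_deriv_diff)
  show ?thesis
    unfolding elliptic_op_def d2 d1[OF S(2)]
    by (simp add: right_diff_distrib sum_subtractf)
qed

text \<open>Continuous partial derivatives imply total differentiability. \<open>Ck_on\<close>
  speaks only of the coordinate directions, while the second derivative test has to follow lines in
  every direction. The coordinates of the increment are switched on one at a time, by induction on
  the set \<open>I\<close> of those already moved; each new one costs one use of the mean value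
  theorem.\<close>

lemma has_derivative_partial_deriv:
  fixes S :: "(real ^ 'n) set"
  assumes S: "open S" "x \<in> S" and u: "Ck_on (Suc 0) S u"
  shows "(u has_derivative (\<lambda>h. \<Sum>i\<in>UNIV. h $ i * partial_deriv i u x)) (at x)"
proof -
  \<comment> \<open>The part of \<open>h\<close> supported on the coordinates in
    \<open>I\<close>.\<close>
  let ?r = "\<lambda>I h. \<Sum>i\<in>I. (h $ i) *\<^sub>R (axis i 1 :: real ^ 'n)"
  have norm_r: "norm (?r I h) \<le> norm h" if "finite I" for I h
  proof (rule norm_le_componentwise_cart)
    fix k
    have "?r I h $ k = (if k \<in> I then h $ k else 0)"
      using that by (simp add: axis_def if_distrib[of "(*) _"] sum.delta cong: if_cong)
    then show "norm (?r I h $ k) \<le> norm (h $ k)" by simp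
  qed
  have main: "\<exists>d>0. \<forall>h. norm h < d \<longrightarrow>
      \<bar>u (x + ?r I h) - u x - (\<Sum>i\<in>I. h $ i * partial_deriv i u x)\<bar> \<le> e * norm h"
    if "finite I" "e > 0" for I e
    using that
  proof (induction I arbitrary: e rule: finite_induct)
    case empty
    then show ?case by (intro exI[of _ 1]) auto
  next
    case (insert k I)
    obtain d1 where d1: "d1 > 0" "\<And>h. norm h < d1 \<Longrightarrow>
      \<bar>u (x + ?r I h) - u x - (\<Sum>i\<in>I. h $ i * partial_deriv i u x)\<bar> \<le> e / 2 * norm h"
      using insert.IH[of "e/2"] insert.prems by auto
    obtain d2 where d2: "d2 > 0" "ball x d2 \<subseteq> S"
      using S unfolding open_contains_ball by blast
    have "continuous_on S (partial_deriv k u)" using u by simp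
    then have "isCont (partial_deriv k u) x"
      using S by (simp add: continuous_on_eq_continuous_at)
    then obtain d3 where d3: "d3 > 0" "\<And>y. dist y x < d3 \<Longrightarrow>
        \<bar>partial_deriv k u y - partial_deriv k u x\<bar> < e / 2"
      using half_gt_zero[OF insert.prems] unfolding continuous_at_eps_delta dist_real_def
      by meson
    \<comment> \<open>The halving leaves room for two displacements of length at most
      \<open>norm h\<close>: the coordinates in \<open>I\<close>, and then coordinate
      \<open>k\<close>.\<close>
    define d where "d = min d1 (min d2 d3) / 2"
    have "d > 0" "d < d1" "2 * d \<le> d2" "2 * d \<le> d3"
      using d1(1) d2(1) d3(1) by (auto simp: d_def)
    moreover have "\<bar>u (x + ?r (insert k I) h) - u x - (\<Sum>i\<in>insert k I. h $ i * partial_deriv i u x)\<bar> \<le> e * norm h"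
      if h: "norm h < d" for h
    proof -
      \<comment> \<open>\<open>z\<close> is reached after moving the coordinates in
        \<open>I\<close>; \<open>g\<close> then moves coordinate \<open>k\<close> alone.\<close>
      define z where "z = x + ?r I h"
      define g where "g t = u (z + t *\<^sub>R axis k 1)" for t
      have near: "dist (z + t *\<^sub>R axis k 1) x < 2 * d" if "\<bar>t\<bar> \<le> \<bar>h $ k\<bar>" for t
      proof -
        have "norm (z + t *\<^sub>R axis k 1 - x) \<le> norm (?r I h) + \<bar>t\<bar> * norm (axis k 1 :: real ^ 'n)"
          unfolding z_def using norm_triangle_ineq[of "?r I h" "t *\<^sub>R axis k 1"]
          by (simp only: add.assoc add_diff_cancel_left' norm_scaleR)
        also have "\<dots> \<le> norm h + norm h"
          using norm_r[OF insert.hyps(1), of h] that component_le_norm_cart[of h k] by simp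
        finally show ?thesis using h by (simp add: dist_norm)
      qed
      have g': "(g has_real_derivative partial_deriv k u (z + t *\<^sub>R axis k 1)) (at t)"
        if "\<bar>t\<bar> \<le> \<bar>h $ k\<bar>" for t
      proof -
        have "z + t *\<^sub>R axis k 1 \<in> S"
          using near[OF that] \<open>2 * d \<le> d2\<close> by (intro subsetD[OF d2(2)]) (simp add: dist_commute)
        then have "((\<lambda>s. u ((z + t *\<^sub>R axis k 1) + s *\<^sub>R axis k 1)) has_real_derivative
            partial_deriv k u (z + t *\<^sub>R axis k 1)) (at 0)"
          using u by (auto simp: has_partial_deriv_iff)
        then have "((\<lambda>s. g (s + t)) has_real_derivative
            partial_deriv k u (z + t *\<^sub>R axis k 1)) (at 0)"
          by (simp add: g_def algebra_simps)
        then show ?thesis using DERIV_shift[of g _ 0 t] by simp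
      qed
      \<comment> \<open>The mean value theorem on the segment between 0 and \<open>h $ k\<close>,
        whose orientation depends on the sign of \<open>h $ k\<close>.\<close>
      have "\<exists>t. \<bar>t\<bar> \<le> \<bar>h $ k\<bar> \<and> g (h $ k) - g 0 = h $ k * partial_deriv k u (z + t *\<^sub>R axis k 1)"
      proof (cases "h $ k" "0::real" rule: linorder_cases)
        case less
        have "\<exists>t>h $ k. t < 0 \<and> g 0 - g (h $ k) = (0 - h $ k) * partial_deriv k u (z + t *\<^sub>R axis k 1)"
          using less by (intro MVT2 g') auto
        then obtain t where "h $ k < t" "t < 0" "g 0 - g (h $ k) = (0 - h $ k) * partial_deriv k u (z + t *\<^sub>R axis k 1)"
          by blast
        then show ?thesis by (intro exI[of _ t]) auto
      next
        case greater
        have "\<exists>t>0. t < h $ k \<and> g (h $ k) - g 0 = (h $ k - 0) * partial_deriv k u (z + t *\<^sub>R axis k 1)"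
          using greater by (intro MVT2 g') auto
        then obtain t where "0 < t" "t < h $ k" "g (h $ k) - g 0 = (h $ k - 0) * partial_deriv k u (z + t *\<^sub>R axis k 1)"
          by blast
        then show ?thesis by (intro exI[of _ t]) auto
      qed (auto intro!: exI[of _ 0])
      then obtain t where t: "\<bar>t\<bar> \<le> \<bar>h $ k\<bar>"
        "g (h $ k) - g 0 = h $ k * partial_deriv k u (z + t *\<^sub>R axis k 1)" by auto
      have "\<bar>partial_deriv k u (z + t *\<^sub>R axis k 1) - partial_deriv k u x\<bar> < e / 2"
        using near[OF t(1)] \<open>2 * d \<le> d3\<close> by (intro d3(2)) simp
      then have "\<bar>h $ k\<bar> * \<bar>partial_deriv k u (z + t *\<^sub>R axis k 1) - partial_deriv k u x\<bar> \<le> norm h * (e / 2)"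
        by (intro mult_mono component_le_norm_cart) auto
      then have 1: "\<bar>g (h $ k) - g 0 - h $ k * partial_deriv k u x\<bar> \<le> e / 2 * norm h"
        unfolding t(2) right_diff_distrib[symmetric] abs_mult by (simp add: mult.commute)
      have 2: "\<bar>g 0 - u x - (\<Sum>i\<in>I. h $ i * partial_deriv i u x)\<bar> \<le> e / 2 * norm h"
        using d1(2)[of h] h \<open>d < d1\<close> by (simp add: g_def z_def)
      have 3: "u (x + ?r (insert k I) h) = g (h $ k)"
        unfolding g_def z_def sum.insert[OF insert.hyps] by (simp only: add_ac)
      have "u (x + ?r (insert k I) h) - u x - (\<Sum>i\<in>insert k I. h $ i * partial_deriv i u x) =
          (g (h $ k) - g 0 - h $ k * partial_deriv k u x) + (g 0 - u x - (\<Sum>i\<in>I. h $ i * partial_deriv i u x))"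
        unfolding 3 by (simp add: insert.hyps)
      also have "\<bar>\<dots>\<bar> \<le> e / 2 * norm h + e / 2 * norm h"
        using 1 2 by (intro order_trans[OF abs_triangle_ineq] add_mono)
      finally show ?thesis by simp
    qed
    ultimately show ?case by (intro exI[of _ d]) simp
  qed
  have rU: "?r UNIV h = h" for h
    by (simp add: vec_eq_iff axis_def if_distrib[of "(*) _"] sum.delta cong: if_cong)
  have "bounded_linear (\<lambda>h. \<Sum>i\<in>UNIV. h $ i * partial_deriv i u x)"
    by (intro bounded_linear_sum bounded_linear_mult_const bounded_linear_vec_nth)
  moreover have "\<exists>d>0. \<forall>y. norm (y - x) < d \<longrightarrow>
      norm (u y - u x - (\<Sum>i\<in>UNIV. (y - x) $ i * partial_deriv i u x)) \<le> e * norm (y - x)"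
    if e: "e > 0" for e
  proof -
    obtain d where "d > 0" and d: "\<And>h. norm h < d \<Longrightarrow>
       \<bar>u (x + ?r UNIV h) - u x - (\<Sum>i\<in>UNIV. h $ i * partial_deriv i u x)\<bar> \<le> e * norm h"
      using main[OF finite e] by blast
    then show ?thesis
      using d[unfolded rU, of "y - x" for y] by (intro exI[of _ d]) auto
  qed
  ultimately show ?thesis
    unfolding has_derivative_at_alt by blast
qed

lemma has_derivative_along_line:
  assumes "(u has_derivative u') (at (x + t *\<^sub>R \<xi>))"
  shows "((\<lambda>s. u (x + s *\<^sub>R \<xi>)) has_real_derivative u' \<xi>) (at t)"
proof -
  have "((\<lambda>s. u (x + s *\<^sub>R \<xi>)) has_derivative (\<lambda>h. u' (h *\<^sub>R \<xi>))) (at t)"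
    by (rule has_derivative_compose[where f="\<lambda>s. x + s *\<^sub>R \<xi>", OF _ assms])
       (auto intro!: derivative_eq_intros)
  moreover have "u' (h *\<^sub>R \<xi>) = h * u' \<xi>" for h
    using linear_scale[OF has_derivative_linear[OF assms]] by simp
  ultimately show ?thesis
    unfolding has_field_derivative_def by (simp add: mult_commute_abs)
qed

section \<open>The maximum principle\<close>

text \<open>If \<open>q\<close> were positive, \<open>g'\<close> would be positive just to the right
  of its zero at 0, and by the mean value theorem \<open>g\<close> would rise above
  \<open>g 0\<close>.\<close>

lemma second_deriv_nonpos_at_max:
  fixes g :: "real \<Rightarrow> real"
  assumes g: "\<forall>\<^sub>F t in nhds 0. (g has_real_derivative g' t) (at t)"
    and g'': "(g' has_real_derivative q) (at 0)"
    and max: "\<forall>\<^sub>F t in nhds 0. g t \<le> g 0"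
  shows "g' 0 = 0" "q \<le> 0"
proof -
  obtain d where d: "d > 0"
    "\<And>t. \<bar>t\<bar> < d \<Longrightarrow> (g has_real_derivative g' t) (at t)" "\<And>t. \<bar>t\<bar> < d \<Longrightarrow> g t \<le> g 0"
    using eventually_conj[OF g max] unfolding eventually_nhds_metric by (auto simp: dist_real_def)
  show g0: "g' 0 = 0"
    using d by (intro DERIV_local_max[of g _ 0 d]) auto
  show "q \<le> 0"
  proof (rule ccontr)
    assume "\<not> q \<le> 0"
    then obtain e where e: "e > 0" "\<And>h. 0 < h \<Longrightarrow> h < e \<Longrightarrow> g' 0 < g' h"
      using DERIV_pos_inc_right[OF g''] by auto
    define s where "s = min d e / 2"
    have s: "0 < s" "s < d" "s < e" using d(1) e(1) by (auto simp: s_def)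
    obtain t where t: "0 < t" "t < s" "g s - g 0 = (s - 0) * g' t"
      using MVT2[of 0 s g g'] d(2) s by auto
    have "g' t > 0" using e(2)[of t] t s g0 by auto
    then have "g s > g 0" using t s by (simp add: algebra_simps)
    then show False using d(3)[of s] s by auto
  qed
qed

text \<open>The one-variable test is applied to \<open>u\<close> along the line through
  \<open>x\<close> in direction \<xi>: the first derivative there is the gradient paired with \<xi>,
  the second is the Hessian form at \<xi>. Coordinate directions give the vanishing
  gradient.\<close>

lemma local_max_partial_deriv:
  fixes S :: "(real ^ 'n) set"
  assumes S: "open S" "x \<in> S" and u: "Ck_on 2 S u" and max: "\<And>y. y \<in> S \<Longrightarrow> u y \<le> u x"
  shows "partial_deriv i u x = 0"
    and "(\<Sum>i\<in>UNIV. \<Sum>j\<in>UNIV. partial_deriv i (partial_deriv j u) x * \<xi> $ i * \<xi> $ j) \<le> 0"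
proof -
  have C1: "Ck_on (Suc 0) S u" and C1': "\<And>j. Ck_on (Suc 0) S (partial_deriv j u)"
    using u by (auto simp: numeral_2_eq_2)
  define q where "q \<xi> = (\<Sum>j\<in>UNIV. \<xi> $ j * (\<Sum>i\<in>UNIV. \<xi> $ i * partial_deriv i (partial_deriv j u) x))"
    for \<xi> :: "real ^ 'n"
  define g' where "g' \<xi> t = (\<Sum>j\<in>UNIV. \<xi> $ j * partial_deriv j u (x + t *\<^sub>R \<xi>))"
    for \<xi> :: "real ^ 'n" and t
  have *: "g' \<xi> 0 = 0 \<and> q \<xi> \<le> 0" for \<xi>
  proof -
    have in_S: "\<forall>\<^sub>F t in nhds 0. x + t *\<^sub>R \<xi> \<in> S"
      by (rule eventually_line_in_open[OF S])
    have 1: "\<forall>\<^sub>F t in nhds 0. ((\<lambda>t. u (x + t *\<^sub>R \<xi>)) has_real_derivative g' \<xi> t) (at t)"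
      using in_S unfolding g'_def
      by eventually_elim
         (rule has_derivative_along_line[OF has_derivative_partial_deriv[OF S(1) _ C1]])
    have "((\<lambda>t. partial_deriv j u (x + t *\<^sub>R \<xi>)) has_real_derivative
        (\<Sum>i\<in>UNIV. \<xi> $ i * partial_deriv i (partial_deriv j u) x)) (at 0)" for j
      using has_derivative_partial_deriv[OF S C1']
      by (intro has_derivative_along_line) simp
    then have 2: "(g' \<xi> has_real_derivative q \<xi>) (at 0)"
      unfolding g'_def q_def by (intro DERIV_sum DERIV_cmult)
    have 3: "\<forall>\<^sub>F t in nhds 0. u (x + t *\<^sub>R \<xi>) \<le> u (x + 0 *\<^sub>R \<xi>)"
      using in_S by eventually_elim (simp add: max)
    show ?thesis using second_deriv_nonpos_at_max[OF 1 2 3] by simp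
  qed
  show "partial_deriv i u x = 0"
    using *[of "axis i 1"] by (simp add: g'_def axis_def if_distrib[of "\<lambda>x. x * _"] cong: if_cong)
  have "(\<Sum>i\<in>UNIV. \<Sum>j\<in>UNIV. partial_deriv i (partial_deriv j u) x * \<xi> $ i * \<xi> $ j) = q \<xi>"
    unfolding q_def sum_distrib_left by (subst sum.swap) (simp add: mult_ac)
  then show "(\<Sum>i\<in>UNIV. \<Sum>j\<in>UNIV. partial_deriv i (partial_deriv j u) x * \<xi> $ i * \<xi> $ j) \<le> 0"
    using * by simp
qed

text \<open>
  Eliminating one index at a time, \<open>A\<close> is a rank one matrix plus its Schur complement \<open>A'\<close>, which is
  again positive definite. This avoids diagonalising \<open>A\<close>.
\<close>
lemma trace_posdef_nonpos:
  fixes A M :: "'i \<Rightarrow> 'i \<Rightarrow> real"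
  assumes "finite S" and sym: "\<And>i j. A i j = A j i"
    and pos: "\<And>x. \<exists>i\<in>S. x i \<noteq> 0 \<Longrightarrow> (\<Sum>i\<in>S. \<Sum>j\<in>S. A i j * x i * x j) > 0"
    and neg: "\<And>x. (\<Sum>i\<in>S. \<Sum>j\<in>S. M i j * x i * x j) \<le> 0"
  shows "(\<Sum>i\<in>S. \<Sum>j\<in>S. A i j * M i j) \<le> 0"
  using assms
proof (induction S arbitrary: A rule: finite_induct)
  case empty
  then show ?case by simp
next
  case (insert k S)
  note sym = insert.prems(1) and pos = insert.prems(2) and neg = insert.prems(3)
  have zero_outside: "(\<Sum>i\<in>insert k S. \<Sum>j\<in>insert k S. B i j) = (\<Sum>i\<in>S. \<Sum>j\<in>S. B i j)"
    if "\<And>j. B k j = 0" "\<And>i. B i k = 0" for B :: "'i \<Rightarrow> 'i \<Rightarrow> real"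
    using that insert.hyps by simp
  \<comment> \<open>Testing positivity on the \<open>k\<close>-th unit vector makes the pivot
    \<open>A k k\<close> positive.\<close>
  have "(\<Sum>i\<in>insert k S. \<Sum>j\<in>insert k S. A i j * of_bool (i = k) * of_bool (j = k)) = A k k"
    using insert.hyps by (simp add: of_bool_def if_distrib[of "(*) _"] cong: if_cong)
  then have akk: "A k k > 0"
    using pos[of "\<lambda>i. of_bool (i = k)"] by simp
  define A' where "A' i j = A i j - A i k * A j k / A k k" for i j
  have A'0: "A' k j = 0" "A' i k = 0" for i j
    using akk sym[of k j] by (simp_all add: A'_def)
  have "(\<Sum>i\<in>S. \<Sum>j\<in>S. A' i j * M i j) \<le> 0"
  proof (rule insert.IH)
    show "A' i j = A' j i" for i j
      using sym by (simp add: A'_def mult.commute)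
    show "(\<Sum>i\<in>S. \<Sum>j\<in>S. A' i j * x i * x j) > 0" if x: "\<exists>i\<in>S. x i \<noteq> 0" for x
    proof -
      \<comment> \<open>The coordinate \<open>y k\<close> is chosen to kill the rank one part.\<close>
      define s where "s = (\<Sum>i\<in>S. A i k * x i)"
      define y where "y = x(k := - s / A k k)"
      have y: "(\<Sum>i\<in>insert k S. A i k * y i) = 0"
      proof -
        have "(\<Sum>i\<in>S. A i k * y i) = s"
          unfolding s_def y_def using insert.hyps by (intro sum.cong) auto
        then show ?thesis using insert.hyps akk by (simp add: y_def)
      qed
      have "(\<Sum>i\<in>insert k S. \<Sum>j\<in>insert k S. A' i j * y i * y j) =
         (\<Sum>i\<in>insert k S. \<Sum>j\<in>insert k S. A i j * y i * y j - (A i k * y i) * (A j k * y j) / A k k)"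
        by (intro sum.cong refl) (simp add: A'_def field_simps)
      also have "\<dots> = (\<Sum>i\<in>insert k S. \<Sum>j\<in>insert k S. A i j * y i * y j)
           - (\<Sum>i\<in>insert k S. A i k * y i) * (\<Sum>j\<in>insert k S. A j k * y j) / A k k"
        unfolding sum_product sum_subtractf sum_divide_distrib ..
      also have "\<dots> > 0"
      proof -
        have "\<exists>i\<in>insert k S. y i \<noteq> 0"
          using x insert.hyps unfolding y_def by (metis fun_upd_other insertI2)
        then show ?thesis using pos[of y] unfolding y by simp
      qed
      finally have "(\<Sum>i\<in>S. \<Sum>j\<in>S. A' i j * y i * y j) > 0"
        by (subst (asm) zero_outside) (auto simp: A'0)
      moreover have "(\<Sum>i\<in>S. \<Sum>j\<in>S. A' i j * y i * y j) = (\<Sum>i\<in>S. \<Sum>j\<in>S. A' i j * x i * x j)"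
        using insert.hyps by (intro sum.cong refl) (auto simp: y_def)
      ultimately show ?thesis by simp
    qed
    \<comment> \<open>Setting coordinate \<open>k\<close> to zero turns a form over \<open>S\<close>
      into one over the larger index set.\<close>
    show "(\<Sum>i\<in>S. \<Sum>j\<in>S. M i j * x i * x j) \<le> 0" for x
    proof -
      have "(\<Sum>i\<in>S. \<Sum>j\<in>S. M i j * x i * x j) =
          (\<Sum>i\<in>S. \<Sum>j\<in>S. M i j * (x(k := 0)) i * (x(k := 0)) j)"
        using insert.hyps by (intro sum.cong refl) auto
      also have "\<dots> = (\<Sum>i\<in>insert k S. \<Sum>j\<in>insert k S. M i j * (x(k := 0)) i * (x(k := 0)) j)"
        by (subst zero_outside) auto
      finally show ?thesis using neg[of "x(k := 0)"] by linarith
    qed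
  qed
  \<comment> \<open>Paired with \<open>M\<close>, the rank one part gives the form of
    \<open>M\<close> at the \<open>k\<close>-th column of \<open>A\<close>, divided by the pivot,
    hence a nonpositive number.\<close>
  moreover have "(\<Sum>i\<in>insert k S. \<Sum>j\<in>insert k S. A i j * M i j) =
      (\<Sum>i\<in>insert k S. \<Sum>j\<in>insert k S. A' i j * M i j)
      + (\<Sum>i\<in>insert k S. \<Sum>j\<in>insert k S. M i j * A i k * A j k) / A k k"
    unfolding sum_divide_distrib sum.distrib[symmetric]
    using akk by (intro sum.cong refl) (simp add: A'_def field_simps)
  moreover have "(\<Sum>i\<in>insert k S. \<Sum>j\<in>insert k S. A' i j * M i j) = (\<Sum>i\<in>S. \<Sum>j\<in>S. A' i j * M i j)"
    by (subst zero_outside) (auto simp: A'0)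
  moreover have "(\<Sum>i\<in>insert k S. \<Sum>j\<in>insert k S. M i j * A i k * A j k) / A k k \<le> 0"
    using neg[of "\<lambda>i. A i k"] akk by (simp add: divide_nonpos_pos)
  ultimately show ?case by linarith
qed

text \<open>At the maximum the gradient vanishes, the Hessian is negative semidefinite and so has
  nonpositive trace against \<open>a x\<close>, and the sign of \<open>u x\<close> makes the
  zero-order term nonpositive.\<close>

lemma elliptic_op_nonpos_at_max:
  fixes S :: "(real ^ 'n) set"
  assumes S: "open S" "x \<in> S" and u: "Ck_on 2 S u" and max: "\<And>y. y \<in> S \<Longrightarrow> u y \<le> u x"
    and ux: "u x \<ge> 0" and c: "c x \<le> 0" and a: "sym_pos_def (a x)"
  shows "elliptic_op a b c u x \<le> 0"
proof -
  have "(\<Sum>i\<in>UNIV. \<Sum>j\<in>UNIV. a x $ i $ j * partial_deriv i (partial_deriv j u) x) \<le> 0"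
  proof (rule trace_posdef_nonpos)
    show "a x $ i $ j = a x $ j $ i" for i j
      using a unfolding sym_pos_def_def transpose_def by (metis vec_lambda_beta)
    show "(\<Sum>i\<in>UNIV. \<Sum>j\<in>UNIV. a x $ i $ j * y i * y j) > 0" if "\<exists>i\<in>UNIV. y i \<noteq> 0" for y
    proof -
      have "(\<chi> i. y i) \<noteq> 0" using that by (auto simp: vec_eq_iff)
      then show ?thesis using a unfolding sym_pos_def_def quad_form_def by fastforce
    qed
    show "(\<Sum>i\<in>UNIV. \<Sum>j\<in>UNIV. partial_deriv i (partial_deriv j u) x * y i * y j) \<le> 0" for y
      using local_max_partial_deriv(2)[OF S u max, of "\<chi> i. y i"] by simp
  qed simp
  moreover have "c x * u x \<le> 0"
    using ux c by (simp add: mult_nonpos_nonneg)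
  ultimately show ?thesis
    unfolding elliptic_op_def by (simp add: local_max_partial_deriv(1)[OF S u max])
qed

text \<open>A positive maximum over the compact closure cannot lie on the frontier, and at an
  interior point it contradicts the strict inequality \<open>L\<close>.\<close>

lemma weak_maximum_principle:
  fixes D :: "(real ^ 'n) set"
  assumes D: "open D" "bounded D" and u: "Ck_on 2 D u" and cont: "continuous_on (closure D) u"
    and bd: "\<And>x. x \<in> frontier D \<Longrightarrow> u x \<le> 0"
    and c: "\<And>x. x \<in> D \<Longrightarrow> c x \<le> 0" and a: "\<And>x. x \<in> D \<Longrightarrow> sym_pos_def (a x)"
    and L: "\<And>x. x \<in> D \<Longrightarrow> elliptic_op a b c u x > 0"
    and x: "x \<in> D"
  shows "u x \<le> 0"
proof (rule ccontr)
  assume ux: "\<not> u x \<le> 0"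
  have "compact (closure D)" using D by (simp add: compact_closure)
  then obtain z where z: "z \<in> closure D" "\<And>y. y \<in> closure D \<Longrightarrow> u y \<le> u z"
    using continuous_attains_sup[OF _ _ cont] x closure_subset by (metis empty_iff subsetD)
  have uz: "u z > 0" using z(2)[of x] ux x closure_subset[of D] by force
  then have "z \<in> D"
    using z(1) bd[of z] D(1) by (force simp: frontier_def interior_open)
  then have "elliptic_op a b c u z \<le> 0"
    using closure_subset[of D]
    by (intro elliptic_op_nonpos_at_max[OF D(1) _ u z(2)] c a less_imp_le[OF uz]) auto
  with L[OF \<open>z \<in> D\<close>] show False by simp
qed

section \<open>The barrier\<close>

text \<open>Hopf's barrier: it vanishes on the sphere of radius \<open>r\<close> around
  \<open>p\<close> and, for positive \<open>K\<close> and \<alpha>, increases with the distance from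
  \<open>p\<close>.\<close>

definition gauss_barrier :: "real \<Rightarrow> real \<Rightarrow> real \<Rightarrow> real ^ 'n \<Rightarrow> real ^ 'n \<Rightarrow> real" where
  "gauss_barrier K \<alpha> r p x = K * (exp (- \<alpha> * r\<^sup>2) - exp (- \<alpha> * (norm (x - p))\<^sup>2))"

lemma norm_diff_along_axis:
  fixes x p :: "real ^ 'n"
  shows "(norm (x + t *\<^sub>R axis i 1 - p))\<^sup>2 = (norm (x - p))\<^sup>2 + 2 * t * (x - p) $ i + t\<^sup>2"
proof -
  have eq: "x + t *\<^sub>R axis i 1 - p = (x - p) + t *\<^sub>R axis i 1" by simp
  show ?thesis
    unfolding eq power2_norm_eq_inner inner_add_left inner_add_right
    by (simp add: inner_axis inner_axis' power2_eq_square)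
qed

text \<open>The derivative is given as an equality of functions on the whole space, so that it can
  be rewritten under a second \<open>partial_deriv\<close>.\<close>

lemma partial_deriv_gauss_barrier:
  shows "has_partial_deriv i (gauss_barrier K \<alpha> r p) x"
    and "partial_deriv i (gauss_barrier K \<alpha> r p) =
      (\<lambda>x. 2 * \<alpha> * K * (x - p) $ i * exp (- \<alpha> * (norm (x - p))\<^sup>2))"
proof -
  have "((\<lambda>t. gauss_barrier K \<alpha> r p (x + t *\<^sub>R axis i 1)) has_real_derivative
      2 * \<alpha> * K * (x - p) $ i * exp (- \<alpha> * (norm (x - p))\<^sup>2)) (at 0)" for x
    unfolding gauss_barrier_def norm_diff_along_axis
    by (auto intro!: derivative_eq_intros)
  then show "has_partial_deriv i (gauss_barrier K \<alpha> r p) x"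
    and "partial_deriv i (gauss_barrier K \<alpha> r p) =
      (\<lambda>x. 2 * \<alpha> * K * (x - p) $ i * exp (- \<alpha> * (norm (x - p))\<^sup>2))"
    using partial_deriv_eqI by blast+
qed

lemma partial_deriv2_gauss_barrier:
  shows "has_partial_deriv i (partial_deriv j (gauss_barrier K \<alpha> r p)) x"
    and "partial_deriv i (partial_deriv j (gauss_barrier K \<alpha> r p)) =
      (\<lambda>x. 2 * \<alpha> * K * exp (- \<alpha> * (norm (x - p))\<^sup>2)
        * (of_bool (i = j) - 2 * \<alpha> * (x - p) $ i * (x - p) $ j))"
proof -
  have comp: "(x + t *\<^sub>R axis i 1 - p) $ j = (x - p) $ j + t * of_bool (i = j)" for t and x :: "real ^ 'a"
    by (simp add: axis_def)
  have "((\<lambda>t. partial_deriv j (gauss_barrier K \<alpha> r p) (x + t *\<^sub>R axis i 1)) has_real_derivative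
      2 * \<alpha> * K * exp (- \<alpha> * (norm (x - p))\<^sup>2)
        * (of_bool (i = j) - 2 * \<alpha> * (x - p) $ i * (x - p) $ j)) (at 0)" for x
    unfolding partial_deriv_gauss_barrier norm_diff_along_axis comp
    by (auto intro!: derivative_eq_intros simp: algebra_simps)
  then show "has_partial_deriv i (partial_deriv j (gauss_barrier K \<alpha> r p)) x"
    and "partial_deriv i (partial_deriv j (gauss_barrier K \<alpha> r p)) =
      (\<lambda>x. 2 * \<alpha> * K * exp (- \<alpha> * (norm (x - p))\<^sup>2)
        * (of_bool (i = j) - 2 * \<alpha> * (x - p) $ i * (x - p) $ j))"
    using partial_deriv_eqI by blast+
qed

lemma Ck_on_gauss_barrier: "Ck_on 2 S (gauss_barrier K \<alpha> r p)"
proof -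
  have "continuous_on S (gauss_barrier K \<alpha> r p)"
    unfolding gauss_barrier_def by (intro continuous_intros)
  moreover have "continuous_on S (partial_deriv i (gauss_barrier K \<alpha> r p))" for i
    unfolding partial_deriv_gauss_barrier by (intro continuous_intros)
  moreover have "continuous_on S (partial_deriv i (partial_deriv j (gauss_barrier K \<alpha> r p)))" for i j
    unfolding partial_deriv2_gauss_barrier by (intro continuous_intros)
  ultimately show ?thesis
    by (simp add: numeral_2_eq_2 partial_deriv_gauss_barrier(1) partial_deriv2_gauss_barrier(1))
qed

lemma elliptic_op_gauss_barrier:
  "elliptic_op a b c (gauss_barrier K \<alpha> r p) x =
     2 * \<alpha> * K * exp (- \<alpha> * (norm (x - p))\<^sup>2) *
       ((\<Sum>i\<in>UNIV. a x $ i $ i) - 2 * \<alpha> * quad_form (a x) (x - p) + b x \<bullet> (x - p))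
     + c x * gauss_barrier K \<alpha> r p x"
proof -
  define E where "E = 2 * \<alpha> * K * exp (- \<alpha> * (norm (x - p))\<^sup>2)"
  have "(\<Sum>i\<in>UNIV. \<Sum>j\<in>UNIV. a x $ i $ j * (E * (of_bool (i = j) - 2 * \<alpha> * (x - p) $ i * (x - p) $ j)))
     = (\<Sum>i\<in>UNIV. \<Sum>j\<in>UNIV. E * (a x $ i $ j * of_bool (i = j)) - E * (2 * \<alpha>) * (a x $ i $ j * (x - p) $ i * (x - p) $ j))"
    by (intro sum.cong refl) (simp add: algebra_simps)
  also have "\<dots> = E * (\<Sum>i\<in>UNIV. \<Sum>j\<in>UNIV. a x $ i $ j * of_bool (i = j)) - E * (2 * \<alpha>) * quad_form (a x) (x - p)"
    unfolding quad_form_def sum_subtractf sum_distrib_left ..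
  also have "(\<Sum>i\<in>UNIV. \<Sum>j\<in>UNIV. a x $ i $ j * of_bool (i = j)) = (\<Sum>i\<in>UNIV. a x $ i $ i)"
    by (simp add: of_bool_def if_distrib[of "(*) _"] cong: if_cong)
  finally have 1: "(\<Sum>i\<in>UNIV. \<Sum>j\<in>UNIV. a x $ i $ j * (E * (of_bool (i = j) - 2 * \<alpha> * (x - p) $ i * (x - p) $ j)))
     = E * (\<Sum>i\<in>UNIV. a x $ i $ i) - E * (2 * \<alpha>) * quad_form (a x) (x - p)" .
  have 2: "(\<Sum>i\<in>UNIV. b x $ i * (2 * \<alpha> * K * (x - p) $ i * exp (- \<alpha> * (norm (x - p))\<^sup>2))) = E * (b x \<bullet> (x - p))"
    unfolding E_def inner_vec_def sum_distrib_left by (intro sum.cong refl) simp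
  show ?thesis
    unfolding elliptic_op_def partial_deriv2_gauss_barrier(2) unfolding partial_deriv_gauss_barrier(2) 2
    unfolding E_def[symmetric] 1 by (simp add: algebra_simps)
qed

lemma gauss_barrier_nonneg:
  assumes "K \<ge> 0" "\<alpha> \<ge> 0" "0 \<le> r" "r \<le> dist x p"
  shows "gauss_barrier K \<alpha> r p x \<ge> 0"
  unfolding gauss_barrier_def using assms
  by (auto intro!: mult_nonneg_nonneg mult_left_mono power_mono simp: dist_norm)

text \<open>The hypothesis \<open>less\<close> says that \<alpha> is large enough for the quadratic
  term to beat trace and drift. The zero-order term has the right sign because the barrier is
  nonnegative outside the ball.\<close>

lemma elliptic_op_gauss_barrier_neg:
  assumes pos: "\<alpha> > 0" "K > 0" "0 \<le> r" "r \<le> dist x p" and c: "c x \<le> 0"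
    and less: "(\<Sum>i\<in>UNIV. a x $ i $ i) + b x \<bullet> (x - p) < 2 * \<alpha> * quad_form (a x) (x - p)"
  shows "elliptic_op a b c (gauss_barrier K \<alpha> r p) x < 0"
proof -
  have "2 * \<alpha> * K * exp (- \<alpha> * (norm (x - p))\<^sup>2) *
       ((\<Sum>i\<in>UNIV. a x $ i $ i) - 2 * \<alpha> * quad_form (a x) (x - p) + b x \<bullet> (x - p)) < 0"
    using pos less by (intro mult_pos_neg) auto
  moreover have "c x * gauss_barrier K \<alpha> r p x \<le> 0"
    using gauss_barrier_nonneg[of K \<alpha> r x p] pos c by (intro mult_nonpos_nonneg) auto
  ultimately show ?thesis unfolding elliptic_op_gauss_barrier by linarith
qed

text \<open>Comparison of \<open>w\<close> with the barrier on the part of \<Omega> within distance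
  \<open>R\<close> of \<open>p\<close>. The quotient in the conclusion normalises the barrier to
  equal \<open>M\<close> at distance \<open>R\<close>.\<close>

lemma bounded_by_gauss_barrier:
  fixes \<Omega> :: "(real ^ 'n) set"
  assumes \<Omega>: "open \<Omega>" and w: "Ck_on 2 \<Omega> w" and cont: "continuous_on (closure \<Omega>) w"
    and bd: "\<And>y. y \<in> frontier \<Omega> \<Longrightarrow> w y \<le> 0"
    and L: "\<And>y. y \<in> \<Omega> \<Longrightarrow> elliptic_op a b c w y \<ge> 0"
    and c: "\<And>y. y \<in> \<Omega> \<Longrightarrow> c y \<le> 0" and a: "\<And>y. y \<in> \<Omega> \<Longrightarrow> sym_pos_def (a y)"
    and M: "M > 0" "\<And>y. y \<in> \<Omega> \<Longrightarrow> w y \<le> M"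
    and r: "0 < r" "r < R" "\<And>y. y \<in> closure \<Omega> \<Longrightarrow> r \<le> dist y p"
    and \<alpha>: "\<alpha> > 0"
    and less: "\<And>y. y \<in> \<Omega> \<Longrightarrow> dist y p < R \<Longrightarrow>
        (\<Sum>i\<in>UNIV. a y $ i $ i) + b y \<bullet> (y - p) < 2 * \<alpha> * quad_form (a y) (y - p)"
    and x: "x \<in> \<Omega>" "dist x p < R"
  shows "w x \<le> gauss_barrier (M / (exp (- \<alpha> * r\<^sup>2) - exp (- \<alpha> * R\<^sup>2))) \<alpha> r p x"
proof -
  define K where "K = M / (exp (- \<alpha> * r\<^sup>2) - exp (- \<alpha> * R\<^sup>2))"
  define h where "h = gauss_barrier K \<alpha> r p"
  have denom: "exp (- \<alpha> * r\<^sup>2) - exp (- \<alpha> * R\<^sup>2) > 0"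
    using r \<alpha> by (simp add: power_strict_mono)
  then have K: "K > 0" using M by (simp add: K_def)
  have hR: "h y = M" if "dist y p = R" for y
    using that less_imp_neq[OF denom] by (simp add: h_def gauss_barrier_def K_def dist_norm)
  define D where "D = \<Omega> \<inter> ball p R"
  have D: "open D" "bounded D" "D \<subseteq> \<Omega>" "x \<in> D"
    using \<Omega> x by (auto simp: D_def dist_commute intro: open_Int)
  have "closure D \<subseteq> closure \<Omega>" by (rule closure_mono[OF D(3)])
  moreover have "closure D \<subseteq> cball p R" by (rule closure_minimal) (auto simp: D_def)
  ultimately have clD: "closure D \<subseteq> closure \<Omega>" "closure D \<subseteq> cball p R" .
  \<comment> \<open>The bound is extended to the closure because the outer part of the frontier of
    \<open>D\<close> may touch the frontier of \<Omega>.\<close>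
  have wM: "w y \<le> M" if "y \<in> closure \<Omega>" for y
    using continuous_le_on_closure[OF cont that] M(2) by blast
  have C2: "Ck_on 2 D w" "Ck_on 2 D h"
    using Ck_on_subset[OF w D(3)] Ck_on_gauss_barrier by (auto simp: h_def)
  have "w x - h x \<le> 0"
  proof (rule weak_maximum_principle[OF D(1,2), where u = "\<lambda>x. w x - h x" and a = a and b = b and c = c])
    show "Ck_on 2 D (\<lambda>x. w x - h x)" by (rule Ck_on_diff[OF D(1) C2])
    have "continuous_on (closure D) h"
      unfolding h_def gauss_barrier_def by (intro continuous_intros)
    then show "continuous_on (closure D) (\<lambda>x. w x - h x)"
      using continuous_on_subset[OF cont clD(1)] by (intro continuous_on_diff)
    show "w y - h y \<le> 0" if y: "y \<in> frontier D" for y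
    proof -
      have y': "y \<in> closure \<Omega>" "dist y p \<le> R" "y \<notin> D"
        using y clD D(1) by (auto simp: frontier_def interior_open dist_commute)
      show ?thesis
      \<comment> \<open>Inside the open ball a frontier point of \<open>D\<close> is one of
        \<Omega>, where \<open>w\<close> is nonpositive and the barrier nonnegative. On the sphere
        of radius \<open>R\<close> the barrier equals \<open>M\<close>.\<close>
      proof (cases "dist y p < R")
        case True
        then have "y \<in> frontier \<Omega>"
          using y' \<Omega> by (auto simp: D_def frontier_def interior_open dist_commute)
        then have "w y \<le> 0" by (rule bd)
        moreover have "h y \<ge> 0"
          unfolding h_def using K \<alpha> r y' by (intro gauss_barrier_nonneg) auto
        ultimately show ?thesis by linarith
      next
        case False
        then show ?thesis using y' wM[of y] hR[of y] by simp
      qed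
    qed
    \<comment> \<open>The strictness comes entirely from the barrier, since \<open>w\<close> is only
      a subsolution.\<close>
    show "0 < elliptic_op a b c (\<lambda>x. w x - h x) y" if y: "y \<in> D" for y
    proof -
      have y': "y \<in> \<Omega>" "y \<in> closure \<Omega>" "dist y p < R"
        using y closure_subset[of \<Omega>] by (auto simp: D_def dist_commute)
      have "elliptic_op a b c h y < 0"
        unfolding h_def using y' r(1) r(3)[of y] by (intro elliptic_op_gauss_barrier_neg \<alpha> K c less) auto
      then show ?thesis
        using L[OF y'(1)] unfolding elliptic_op_diff[OF D(1) y C2] by linarith
    qed
  qed (use D c a in auto)
  then show ?thesis by (simp add: h_def K_def)
qed

section \<open>Exterior balls, thickness and supremum norms\<close>

text \<open>If the open ball met the closure of \<Omega>, it would meet \<Omega> itself. The common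
  point would have to be \<open>x0\<close>, but a frontier point of an open set is not in the
  set.\<close>

lemma exterior_sphere_dist:
  fixes \<Omega> :: "(real ^ 'n) set"
  assumes \<Omega>: "open \<Omega>" and r: "r > 0" and x0: "x0 \<in> frontier \<Omega>"
    and touch: "closure (ball p r) \<inter> closure \<Omega> = {x0}"
  shows "dist x0 p \<le> r" and "y \<in> closure \<Omega> \<Longrightarrow> r \<le> dist y p"
proof -
  show "dist x0 p \<le> r"
    using touch r by (auto simp: closure_ball dist_commute)
  show "r \<le> dist y p" if y: "y \<in> closure \<Omega>"
  proof (rule ccontr)
    assume "\<not> r \<le> dist y p"
    then have "y \<in> ball p r" by (simp add: dist_commute)
    then have "ball p r \<inter> \<Omega> \<noteq> {}"
      using y open_Int_closure_eq_empty[of "ball p r" \<Omega>] by auto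
    then obtain z where "z \<in> ball p r" "z \<in> \<Omega>" by auto
    then have "z = x0" using touch closure_subset by blast
    then show False using x0 \<open>z \<in> \<Omega>\<close> \<Omega> by (simp add: frontier_def interior_open)
  qed
qed

text \<open>An infimum below a real number is undercut by some frontier point. Existence of that
  point is part of the conclusion: over an empty frontier the infimum would be infinite.\<close>

lemma bounded_thicknessE:
  assumes "bounded_thickness \<Omega>"
  obtains d where "d > 0" "\<And>x. x \<in> \<Omega> \<Longrightarrow> \<exists>y\<in>frontier \<Omega>. dist x y < d"
proof -
  obtain d where d: "(SUP x\<in>\<Omega>. edist_set x (frontier \<Omega>)) < ereal d"
    using ereal_dense2[OF assms[unfolded bounded_thickness_def]] by blast
  have "\<exists>y\<in>frontier \<Omega>. dist x y < max d 1" if "x \<in> \<Omega>" for x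
  proof -
    have "edist_set x (frontier \<Omega>) < ereal d"
      using d that by (meson SUP_upper le_less_trans)
    then show ?thesis unfolding edist_set_def INF_less_iff by (auto simp: less_max_iff_disj)
  qed
  then show thesis by (intro that[of "max d 1"]) auto
qed

lemma sup_norm_upper: "x \<in> S \<Longrightarrow> ereal \<bar>f x\<bar> \<le> sup_norm S f"
  unfolding sup_norm_def by (rule SUP_upper)


section \<open>Uniqueness\<close>

theorem theorem2:
  fixes \<Omega> :: "(real ^ 'n) set"
    and a :: "real ^ 'n \<Rightarrow> real ^ 'n ^ 'n"
    and b :: "real ^ 'n \<Rightarrow> real ^ 'n"
    and c f g u1 u2 :: "real ^ 'n \<Rightarrow> real"
    and H \<Lambda> :: real
  assumes domain: "open \<Omega>" "connected \<Omega>" "\<Omega> \<noteq> {}"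
    and unbounded: "\<not> bounded \<Omega>"
    and a_cont: "\<And>i j. continuous_on (closure \<Omega>) (\<lambda>x. a x $ i $ j)"
    and b_cont: "\<And>i. continuous_on (closure \<Omega>) (\<lambda>x. b x $ i)"
    and c_cont: "continuous_on (closure \<Omega>) c"
    and a_spd: "\<And>x. x \<in> closure \<Omega> \<Longrightarrow> sym_pos_def (a x)"
    and coeff_bound: "\<And>i j. sup_norm \<Omega> (\<lambda>x. a x $ i $ j) + sup_norm \<Omega> (\<lambda>x. b x $ i)
                         + sup_norm \<Omega> c \<le> ereal H"
    and c_nonpos: "\<And>x. x \<in> \<Omega> \<Longrightarrow> c x \<le> 0"
    and elliptic: "\<And>x \<xi>. x \<in> \<Omega> \<Longrightarrow>
                     1 / \<Lambda> * (norm \<xi>)\<^sup>2 \<le> quad_form (a x) \<xi> \<and>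
                     quad_form (a x) \<xi> \<le> \<Lambda> * (norm \<xi>)\<^sup>2"
    and thickness: "bounded_thickness \<Omega>"
    and sol1: "dirichlet_solution \<Omega> a b c f g u1"
    and sol2: "dirichlet_solution \<Omega> a b c f g u2"
    and diff_bounded: "\<exists>K. \<forall>x\<in>\<Omega>. \<bar>u1 x - u2 x\<bar> \<le> K"
    and exterior_sphere: "uniform_exterior_sphere \<Omega>"
  shows "\<forall>x\<in>\<Omega>. u1 x = u2 x"
proof (rule ccontr)
  assume "\<not> (\<forall>x\<in>\<Omega>. u1 x = u2 x)"
  then obtain z where z: "z \<in> \<Omega>" "u1 z \<noteq> u2 z" by auto
  obtain K where K: "\<And>x. x \<in> \<Omega> \<Longrightarrow> \<bar>u1 x - u2 x\<bar> \<le> K" using diff_bounded by auto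
  define M where "M = (SUP x\<in>\<Omega>. \<bar>u1 x - u2 x\<bar>)"
  have bdd: "bdd_above ((\<lambda>x. \<bar>u1 x - u2 x\<bar>) ` \<Omega>)"
    using K by (intro bdd_aboveI2[of _ _ K]) auto
  have M_upper: "\<bar>u1 x - u2 x\<bar> \<le> M" if "x \<in> \<Omega>" for x
    unfolding M_def by (rule cSUP_upper[OF that bdd])
  have "M > 0" using M_upper[OF z(1)] z(2) by linarith
  obtain d where d: "d > 0" "\<And>x. x \<in> \<Omega> \<Longrightarrow> \<exists>y\<in>frontier \<Omega>. dist x y < d"
    using bounded_thicknessE[OF thickness] by blast
  obtain r where r: "r > 0" "\<And>x0. x0 \<in> frontier \<Omega> \<Longrightarrow> \<exists>p. closure (ball p r) \<inter> closure \<Omega> = {x0}"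
    using exterior_sphere unfolding uniform_exterior_sphere_def by blast
  have coeff: "\<bar>a x $ i $ i\<bar> + \<bar>b x $ i\<bar> \<le> H" if "x \<in> \<Omega>" for x i
  proof -
    have "ereal \<bar>a x $ i $ i\<bar> + ereal \<bar>b x $ i\<bar> + ereal \<bar>c x\<bar>
        \<le> sup_norm \<Omega> (\<lambda>x. a x $ i $ i) + sup_norm \<Omega> (\<lambda>x. b x $ i) + sup_norm \<Omega> c"
      by (intro add_mono sup_norm_upper[OF that, of "\<lambda>x. a x $ i $ i"]
          sup_norm_upper[OF that, of "\<lambda>x. b x $ i"] sup_norm_upper[OF that])
    also have "\<dots> \<le> ereal H" by (rule coeff_bound)
    finally show ?thesis by simp
  qed
  have "H \<ge> 0" using coeff[OF z(1)] abs_ge_zero by (meson add_nonneg_nonneg order_trans)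
  \<comment> \<open>The form is positive at a unit vector and bounded there by \<Lambda>. The index
    \<open>undefined\<close> merely picks some coordinate.\<close>
  have "\<Lambda> > 0"
  proof -
    define \<xi> :: "real ^ 'n" where "\<xi> = axis undefined 1"
    have "norm \<xi> = 1" by (simp add: \<xi>_def)
    moreover have "sym_pos_def (a z)"
      using a_spd z(1) closure_subset by blast
    then have "quad_form (a z) \<xi> > 0"
      using \<open>norm \<xi> = 1\<close> unfolding sym_pos_def_def by (metis norm_zero zero_neq_one)
    ultimately show ?thesis using elliptic[OF z(1), of \<xi>] by simp
  qed
  \<comment> \<open>A point of \<Omega> is closer than \<open>d\<close> to a frontier point, which
    is within \<open>r\<close> of the centre of its exterior ball. \<open>R\<close> has to exceed
    \<rho> strictly, so that the barrier at distance \<rho> stays below \<open>M\<close>.\<close>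
  define \<rho> where "\<rho> = d + r"
  define R where "R = 2 * \<rho>"
  define N where "N = real CARD('n)"
  \<comment> \<open>Here \<open>N * (H + H * R)\<close> bounds trace plus drift within distance
    \<open>R\<close> of the centre, and ellipticity bounds the form below by
    \<open>r\<^sup>2 / \<Lambda>\<close> outside the exterior ball. The summand 1 makes the
    comparison strict.\<close>
  define \<alpha> where "\<alpha> = \<Lambda> * (N * (H + H * R) + 1) / (2 * r\<^sup>2)"
  have rR: "r < \<rho>" "\<rho> < R" "0 < \<rho>" using d r by (auto simp: \<rho>_def R_def)
  have "N * (H + H * R) \<ge> 0"
    using \<open>H \<ge> 0\<close> rR by (simp add: N_def)
  then have "\<alpha> > 0"
    using \<open>\<Lambda> > 0\<close> r by (simp add: \<alpha>_def)
  have \<alpha>_eq: "2 * \<alpha> * (1 / \<Lambda> * r\<^sup>2) = N * (H + H * R) + 1"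
    using \<open>\<Lambda> > 0\<close> r by (simp add: \<alpha>_def field_simps)
  have less: "(\<Sum>i\<in>UNIV. a y $ i $ i) + b y \<bullet> (y - p) < 2 * \<alpha> * quad_form (a y) (y - p)"
    if y: "y \<in> \<Omega>" "dist y p < R" "r \<le> dist y p" for y p
  proof -
    have "a y $ i $ i + b y $ i * (y - p) $ i \<le> H + H * R" for i
    proof -
      have "\<bar>b y $ i\<bar> \<le> H" "\<bar>(y - p) $ i\<bar> \<le> R"
        using coeff[OF y(1), of i] y(2) component_le_norm_cart[of "y - p" i] by (auto simp: dist_norm)
      then have "\<bar>b y $ i\<bar> * \<bar>(y - p) $ i\<bar> \<le> H * R"
        using \<open>H \<ge> 0\<close> by (intro mult_mono) auto
      then show ?thesis
        using coeff[OF y(1), of i] abs_ge_self[of "b y $ i * (y - p) $ i"] unfolding abs_mult by linarith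
    qed
    then have "(\<Sum>i\<in>UNIV. a y $ i $ i + b y $ i * (y - p) $ i) \<le> (\<Sum>i\<in>(UNIV :: 'n set). H + H * R)"
      by (intro sum_mono)
    then have "(\<Sum>i\<in>UNIV. a y $ i $ i) + b y \<bullet> (y - p) \<le> N * (H + H * R)"
      by (simp add: sum.distrib inner_vec_def N_def)
    also have "\<dots> < 2 * \<alpha> * (1 / \<Lambda> * r\<^sup>2)" unfolding \<alpha>_eq by simp
    also have "\<dots> \<le> 2 * \<alpha> * (1 / \<Lambda> * (norm (y - p))\<^sup>2)"
      using \<open>\<alpha> > 0\<close> \<open>\<Lambda> > 0\<close> r y by (intro mult_left_mono power_mono) (auto simp: dist_norm)
    also have "\<dots> \<le> 2 * \<alpha> * quad_form (a y) (y - p)"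
      using \<open>\<alpha> > 0\<close> elliptic[OF y(1), of "y - p"] by (intro mult_left_mono) auto
    finally show ?thesis .
  qed
  define K' where "K' = M / (exp (- \<alpha> * r\<^sup>2) - exp (- \<alpha> * R\<^sup>2))"
  \<comment> \<open>The value of the barrier at distance \<rho>. It depends on neither the point nor
    the centre of the exterior ball.\<close>
  define M' where "M' = K' * (exp (- \<alpha> * r\<^sup>2) - exp (- \<alpha> * \<rho>\<^sup>2))"
  have exps: "exp (- \<alpha> * \<rho>\<^sup>2) < exp (- \<alpha> * r\<^sup>2)" "exp (- \<alpha> * R\<^sup>2) < exp (- \<alpha> * \<rho>\<^sup>2)"
    using rR r \<open>\<alpha> > 0\<close> by (simp_all add: power_strict_mono)
  have "K' > 0" using exps \<open>M > 0\<close> by (simp add: K'_def)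
  have "M' < K' * (exp (- \<alpha> * r\<^sup>2) - exp (- \<alpha> * R\<^sup>2))"
    unfolding M'_def using exps \<open>K' > 0\<close> by (intro mult_strict_left_mono) auto
  also have "\<dots> = M"
    using less_imp_neq[OF less_trans[OF exps(2,1)]] by (simp add: K'_def)
  finally have "M' < M" .
  \<comment> \<open>Stated for any two solutions so that it serves both orders of \<open>u1\<close>
    and \<open>u2\<close>, giving a bound on the absolute value.\<close>
  have improve: "v1 x - v2 x \<le> M'"
    if v1: "dirichlet_solution \<Omega> a b c f g v1" and v2: "dirichlet_solution \<Omega> a b c f g v2"
      and vM: "\<And>y. y \<in> \<Omega> \<Longrightarrow> v1 y - v2 y \<le> M" and x: "x \<in> \<Omega>" for v1 v2 x
  proof -
    obtain x0 where x0: "x0 \<in> frontier \<Omega>" "dist x x0 < d" using d(2)[OF x] by blast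
    obtain p where p: "closure (ball p r) \<inter> closure \<Omega> = {x0}" using r(2)[OF x0(1)] by blast
    note ext = exterior_sphere_dist[OF domain(1) r(1) x0(1) p]
    have xp: "dist x p < \<rho>"
      using x0(2) ext(1) dist_triangle[of x p x0] by (simp add: \<rho>_def)
    have C2: "Ck_on 2 \<Omega> v1" "Ck_on 2 \<Omega> v2"
      using v1 v2 by (auto simp: dirichlet_solution_def)
    have "v1 x - v2 x \<le> gauss_barrier (M / (exp (- \<alpha> * r\<^sup>2) - exp (- \<alpha> * R\<^sup>2))) \<alpha> r p x"
    proof (rule bounded_by_gauss_barrier[OF domain(1) Ck_on_diff[OF domain(1) C2] _ _ _
          c_nonpos _ \<open>M > 0\<close> vM r(1) _ ext(2) \<open>\<alpha> > 0\<close>, where a = a and b = b])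
      show "continuous_on (closure \<Omega>) (\<lambda>x. v1 x - v2 x)"
        using v1 v2 by (auto simp: dirichlet_solution_def intro: continuous_on_diff)
      show "v1 y - v2 y \<le> 0" if "y \<in> frontier \<Omega>" for y
        using v1 v2 that by (auto simp: dirichlet_solution_def)
      show "0 \<le> elliptic_op a b c (\<lambda>x. v1 x - v2 x) y" if "y \<in> \<Omega>" for y
        using v1 v2 that elliptic_op_diff[OF domain(1) that C2] by (auto simp: dirichlet_solution_def)
      show "sym_pos_def (a y)" if "y \<in> \<Omega>" for y
        using a_spd that closure_subset by blast
      show "r < R" "dist x p < R" using rR xp by auto
      show "(\<Sum>i\<in>UNIV. a y $ i $ i) + b y \<bullet> (y - p) < 2 * \<alpha> * quad_form (a y) (y - p)"
        if "y \<in> \<Omega>" "dist y p < R" for y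
        using less[OF that] ext(2)[of y] that(1) closure_subset[of \<Omega>] by blast
    qed (use x in auto)
    also have "\<dots> = K' * (exp (- \<alpha> * r\<^sup>2) - exp (- \<alpha> * (dist x p)\<^sup>2))"
      by (simp add: gauss_barrier_def K'_def dist_norm)
    \<comment> \<open>The barrier increases with the distance from \<open>p\<close>, and
      \<open>x\<close> is closer to \<open>p\<close> than \<rho>.\<close>
    also have "\<dots> \<le> M'"
      unfolding M'_def using \<open>K' > 0\<close> \<open>\<alpha> > 0\<close> xp by (intro mult_left_mono) (auto intro!: power_mono)
    finally show ?thesis .
  qed
  have "\<bar>u1 x - u2 x\<bar> \<le> M'" if "x \<in> \<Omega>" for x
  proof (rule abs_leI)
    show "u1 x - u2 x \<le> M'"
      by (rule improve[OF sol1 sol2 _ that]) (use M_upper in force)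
    have "u2 x - u1 x \<le> M'"
      by (rule improve[OF sol2 sol1 _ that]) (use M_upper in force)
    then show "- (u1 x - u2 x) \<le> M'" by simp
  qed
  \<comment> \<open>\<open>M\<close> is the least upper bound of the absolute difference, so the
    improved bound \<open>M'\<close> cannot be smaller.\<close>
  then have "M \<le> M'"
    unfolding M_def by (intro cSUP_least domain(3))
  with \<open>M' < M\<close> show False by simp
qed

end
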